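(* Let $b\ge 2$ be an integer. Then, as $x\to\infty$, \[\sum_{n\leq x}h_b(n)= \frac{\zeta(2b-1)}{2\zeta(2b)}x^2+O_b(E_b(x)),\] where $E_2(x)=O(x\log x)$, and $E_b(x)=O(x)$ for $b\ge 3$.
   Context: For an integer $b\ge 2$ and positive integers $m,n$, the generalized gcd is $(m,n)_b:=\max\{d\ge 1: d^b\mid m \text{ and } d^b\mid n\}$. The generalized gcd-sum function is $h_b(n):=\sum_{1\le j\le n}(j,n)_b$. Here $\zeta$ is the Riemann zeta function, $x$ is a real variable, sums over $n\le x$ run over positive integers $n$, and $O_b$ means that the implied constant may depend on $b$. *)

theory Defs
  imports "HOL-Analysis.Analysis" "HOL-Library.Landau_Symbols"
begin

(* For m > 0 or n > 0 and b > 0 the set is finite and contains 1, so Max is the true maximum. *)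
definition gen_gcd :: "nat \<Rightarrow> nat \<Rightarrow> nat \<Rightarrow> nat" where
  "gen_gcd b m n = Max {d. d \<ge> 1 \<and> d ^ b dvd m \<and> d ^ b dvd n}"

definition gen_gcd_sum :: "nat \<Rightarrow> nat \<Rightarrow> nat" where
  "gen_gcd_sum b n = (\<Sum>j=1..n. gen_gcd b j n)"

(* The Riemann zeta function on the real half-line s > 1, given by its Dirichlet series;
   no continuation is provided, and the value for s \<le> 1 is meaningless. *)
definition zeta :: "real \<Rightarrow> real" where
  "zeta s = (\<Sum>k. 1 / real (Suc k) powr s)"

end

theory Submission
  imports Defs "HOL-Number_Theory.Totient"
begin

text \<open>
  Since \<open>d\<^sup>b\<close> divides both \<open>j\<close> and \<open>n\<close> exactly when \<open>d\<close> divides \<open>(j, n)\<^sub>b\<close>, the identity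
  \<open>\<Sum>d | d dvd g. \<phi> d = g\<close> turns the double sum over \<open>j \<le> n \<le> x\<close> into the sum over \<open>d\<close> of
  \<open>\<phi> d \<cdot> k (k + 1) / 2\<close>, where \<open>k\<close> is the integer part of \<open>y = x / d\<^sup>b\<close>. As \<open>k (k + 1) / 2\<close> differs from
  \<open>y\<^sup>2 / 2\<close> by at most \<open>y / 2\<close>, the main term is \<open>x\<^sup>2 / 2\<close> times the Dirichlet series of \<open>\<phi>\<close> at \<open>2 b\<close>,
  which is \<open>\<zeta> (2 b - 1) / \<zeta> (2 b)\<close>. Truncating that series at \<open>d \<le> x\<close> costs \<open>O(x)\<close>, and
  the remaining error is at most \<open>x / 2\<close> times the sum of \<open>d / d\<^sup>b\<close> over \<open>d \<le> x\<close>, which is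
  harmonic for \<open>b = 2\<close> and bounded for \<open>b \<ge> 3\<close>.
\<close>

section \<open>Divisors of the generalized gcd\<close>

lemma lcm_power_dvd:
  fixes d e m b :: nat
  assumes "d ^ b dvd m" "e ^ b dvd m"
  shows "lcm d e ^ b dvd m"
proof (cases "d = 0 \<or> e = 0")
  case True
  then show ?thesis using assms by auto
next
  case False
  \<comment> \<open>Taking gcds commutes with powers, and lcm times gcd is the product, so both
    sides equal \<open>(d * e) ^ b\<close>; cancelling the gcd shows that lcm commutes with powers
    as well.\<close>
  have "lcm d e ^ b * gcd d e ^ b = lcm (d ^ b) (e ^ b) * gcd d e ^ b"
    by (subst (2) gcd_exp[symmetric]) (simp only: lcm_mult_gcd normalize_nat_def id_apply flip: power_mult_distrib)
  then have "lcm d e ^ b = lcm (d ^ b) (e ^ b)"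
    using False by simp
  then show ?thesis using assms by simp
qed

text \<open>The admissible \<open>d\<close> are closed under lcm, so their maximum absorbs each of
  them: the lcm of the maximum with any member is again a member and cannot exceed it.\<close>

lemma dvd_gen_gcd_iff:
  assumes "b > 0" "n > 0"
  shows "d dvd gen_gcd b m n \<longleftrightarrow> d ^ b dvd m \<and> d ^ b dvd n"
proof -
  let ?A = "{d. d \<ge> 1 \<and> d ^ b dvd m \<and> d ^ b dvd n}"
  let ?g = "gen_gcd b m n"
  have "?A \<subseteq> {..n}"
    using assms by (auto intro: order_trans[OF self_le_power] dest!: dvd_imp_le)
  then have fin: "finite ?A" by (rule finite_subset) simp
  have "1 \<in> ?A" by simp
  then have g: "?g \<in> ?A"
    unfolding gen_gcd_def using fin Max_in by blast
  show ?thesis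
  proof
    assume "d dvd ?g"
    then have "d ^ b dvd ?g ^ b" by (rule dvd_power_same)
    then show "d ^ b dvd m \<and> d ^ b dvd n" using g dvd_trans by blast
  next
    assume d: "d ^ b dvd m \<and> d ^ b dvd n"
    then have "d > 0" using assms by (cases "d = 0") auto
    then have "lcm d ?g \<in> ?A" using g d by (auto intro: lcm_power_dvd simp: Suc_le_eq lcm_pos_nat)
    then have "lcm d ?g \<le> ?g" unfolding gen_gcd_def by (intro Max_ge fin)
    moreover have "?g \<le> lcm d ?g"
      using \<open>lcm d ?g \<in> ?A\<close> by (intro dvd_imp_le) auto
    ultimately have "lcm d ?g = ?g" by simp
    then show "d dvd ?g" by (metis dvd_lcm1)
  qed
qed

text \<open>Gauss's divisor sum for the totient, written over a range that depends on neither
  \<open>m\<close> nor \<open>n\<close>, so that the sum over \<open>d\<close> can later be moved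
  outside.\<close>

lemma gen_gcd_eq_sum_totient:
  assumes "b > 0" "n > 0" "n \<le> N"
  shows "gen_gcd b m n = (\<Sum>d | d \<in> {1..N} \<and> d ^ b dvd m \<and> d ^ b dvd n. totient d)"
proof -
  have "d \<in> {1..N}" if "d ^ b dvd n" for d
  proof -
    have "d > 0" using that assms by (cases "d = 0") auto
    moreover have "d \<le> d ^ b" using assms \<open>d > 0\<close> by (intro self_le_power) auto
    moreover have "d ^ b \<le> n" using that assms by (intro dvd_imp_le)
    ultimately show ?thesis using assms by simp
  qed
  then have "{d. d \<in> {1..N} \<and> d ^ b dvd m \<and> d ^ b dvd n} = {d. d dvd gen_gcd b m n}"
    using dvd_gen_gcd_iff[OF assms(1,2)] by blast
  then show ?thesis by (simp add: totient_divisor_sum)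
qed

section \<open>Counting multiples and the exact summation formula\<close>

lemma card_multiples:
  fixes q n :: nat
  assumes "q > 0"
  shows "card {j \<in> {1..n}. q dvd j} = n div q"
proof -
  have "{j \<in> {1..n}. q dvd j} = (\<lambda>k. q * k) ` {1..n div q}"
    using assms by (auto simp: less_eq_div_iff_mult_less_eq mult.commute image_iff elim!: dvdE
        intro!: bexI)
  then show ?thesis using assms by (simp add: card_image inj_on_def)
qed

lemma sum_div_multiples:
  fixes q N :: nat
  assumes "q > 0"
  shows "(\<Sum>n | n \<in> {1..N} \<and> q dvd n. n div q) = \<Sum>{1..N div q}"
  using assms
  by (intro sum.reindex_bij_witness[of _ "\<lambda>k. q * k" "\<lambda>n. n div q"])
     (auto simp: less_eq_div_iff_mult_less_eq mult.commute div_le_mono div_greater_zero_iff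
        Suc_le_eq dvd_imp_le)

lemma sum_gen_gcd_sum:
  assumes "b > 0"
  shows "(\<Sum>n=1..N. gen_gcd_sum b n) = (\<Sum>d=1..N. totient d * \<Sum>{1..N div d ^ b})"
proof -
  have "(\<Sum>n=1..N. gen_gcd_sum b n)
      = (\<Sum>n=1..N. \<Sum>j=1..n. \<Sum>d=1..N. if d ^ b dvd j \<and> d ^ b dvd n then totient d else 0)"
    unfolding gen_gcd_sum_def
    by (intro sum.cong refl, subst gen_gcd_eq_sum_totient[OF assms, where N = N])
       (auto simp flip: sum.inter_filter)
  \<comment> \<open>The range of \<open>j\<close> depends on \<open>n\<close>, so \<open>d\<close>
    is moved past \<open>j\<close> first and past \<open>n\<close> afterwards.\<close>
  also have "\<dots> = (\<Sum>n=1..N. \<Sum>d=1..N. \<Sum>j=1..n. if d ^ b dvd j \<and> d ^ b dvd n then totient d else 0)"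
    by (intro sum.cong refl sum.swap)
  also have "\<dots> = (\<Sum>d=1..N. \<Sum>n=1..N. \<Sum>j=1..n. if d ^ b dvd j \<and> d ^ b dvd n then totient d else 0)"
    by (rule sum.swap)
  also have "\<dots> = (\<Sum>d=1..N. \<Sum>n=1..N. if d ^ b dvd n then totient d * (n div d ^ b) else 0)"
  proof (intro sum.cong refl)
    fix d n assume "d \<in> {1..N}"
    then have "(\<Sum>j=1..n. if d ^ b dvd j then totient d else 0) = totient d * (n div d ^ b)"
      using card_multiples[of "d ^ b" n] by (simp flip: sum.inter_filter)
    then show "(\<Sum>j=1..n. if d ^ b dvd j \<and> d ^ b dvd n then totient d else 0)
        = (if d ^ b dvd n then totient d * (n div d ^ b) else 0)"
      by simp
  qed
  \<comment> \<open>Only \<open>n = k * d ^ b\<close> contributes, with weight \<open>k\<close>,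
    which leaves a triangular number.\<close>
  also have "\<dots> = (\<Sum>d=1..N. totient d * \<Sum>{1..N div d ^ b})"
  proof (intro sum.cong refl)
    fix d assume "d \<in> {1..N}"
    then show "(\<Sum>n=1..N. if d ^ b dvd n then totient d * (n div d ^ b) else 0)
        = totient d * \<Sum>{1..N div d ^ b}"
      using sum_div_multiples[of "d ^ b" N]
      by (simp flip: sum.inter_filter sum_distrib_left)
  qed
  finally show ?thesis .
qed

text \<open>Here \<open>k\<close> is the floor of \<open>y\<close>, so \<open>k * (k + 1)\<close>
  lies between \<open>(y - 1) * y\<close> and \<open>y * (y + 1)\<close>.\<close>

lemma triangular_floor_approx:
  fixes k :: nat and y :: real
  assumes "real k \<le> y" "y < real k + 1"
  shows "\<bar>real (\<Sum>{1..k}) - y\<^sup>2 / 2\<bar> \<le> y / 2"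
proof -
  have "2 * (\<Sum>{1..k}) = k * (k + 1)"
    using double_gauss_sum_from_Suc_0[of k, where ?'a = nat] by simp
  then have T: "2 * real (\<Sum>{1..k}) = real k * (real k + 1)"
    by (metis of_nat_1 of_nat_add of_nat_mult of_nat_numeral)
  have "real k * real k \<le> y * y"
    using assms by (intro mult_mono) auto
  then have upper: "real k * (real k + 1) \<le> y * y + y"
    using assms by (simp add: algebra_simps)
  have lower: "y * y - y \<le> real k * (real k + 1)"
  proof (cases "y \<ge> 1")
    case True
    then have "(y - 1) * y \<le> real k * (real k + 1)"
      using assms by (intro mult_mono) auto
    then show ?thesis by (simp add: algebra_simps)
  next
    case False
    then have "(y - 1) * y \<le> 0" using assms by (intro mult_nonpos_nonneg) auto
    then show ?thesis by (simp add: algebra_simps add_nonneg_nonneg order_trans)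
  qed
  show ?thesis
    unfolding abs_le_iff power2_eq_square using T upper lower by linarith
qed

section \<open>Zeta values and the Dirichlet series of the totient\<close>

lemma summable_one_over_power:
  assumes "s \<ge> 2"
  shows "summable (\<lambda>n. 1 / real n ^ s)"
  using inverse_power_summable[OF assms, where ?'a = real] by (simp add: inverse_eq_divide)

lemma zeta_of_nat:
  assumes "s \<ge> 2"
  shows "zeta (real s) = (\<Sum>n. 1 / real n ^ s)"
proof -
  \<comment> \<open>The added term at \<open>n = 0\<close> is \<open>1 / 0 = 0\<close>.\<close>
  have "(\<Sum>n. 1 / real (Suc n) ^ s) = (\<Sum>n. 1 / real n ^ s)"
    using suminf_split_head[OF summable_one_over_power[OF assms]] assms by simp
  then show ?thesis unfolding zeta_def by (simp add: powr_realpow del: of_nat_Suc)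
qed

lemma zeta_of_nat_pos:
  assumes "s \<ge> 2"
  shows "zeta (real s) > 0"
  unfolding zeta_of_nat[OF assms]
  by (rule suminf_pos2[where i = 1]) (use summable_one_over_power[OF assms] in auto)

lemma totient_over_power_le: "real (totient d) / real d ^ Suc s \<le> 1 / real d ^ s"
proof (cases "d = 0")
  case False
  then show ?thesis
    using totient_le[of d] by (simp add: field_simps)
qed auto

lemma summable_totient_over_power:
  assumes "s \<ge> 3"
  shows "summable (\<lambda>d. real (totient d) / real d ^ s)"
proof (rule summable_comparison_test')
  show "summable (\<lambda>d. 1 / real d ^ (s - 1))"
    using assms by (intro summable_one_over_power) simp
  show "norm (real (totient d) / real d ^ s) \<le> 1 / real d ^ (s - 1)" for d
    using totient_over_power_le[of d "s - 1"] assms by simp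
qed

text \<open>Passes from convergent series to unconditional sums over the positive integers, where
  double sums may be rearranged.\<close>

lemma has_sum_pos_nat:
  fixes f :: "nat \<Rightarrow> real"
  assumes "summable f" "\<And>n. f n \<ge> 0" "f 0 = 0"
  shows "(f has_sum suminf f) {0<..}"
proof -
  have "(f has_sum suminf f) UNIV"
    using assms by (intro sums_nonneg_imp_has_sum summable_sums) auto
  then show ?thesis
    by (subst has_sum_cong_neutral[where T = UNIV and g = f]) (use assms in auto)
qed

text \<open>Multiply the series by \<open>zeta s\<close> and group the pairs \<open>(d, e)\<close>
  by their product \<open>n\<close>: the coefficient of \<open>1 / n ^ s\<close> is the divisor sum
  of the totient, namely \<open>n\<close>, which yields \<open>zeta (s - 1)\<close>.\<close>

lemma suminf_totient_over_power:
  assumes "s \<ge> 3"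
  shows "(\<Sum>d. real (totient d) / real d ^ s) = zeta (real (s - 1)) / zeta (real s)"
proof -
  define f where "f = (\<lambda>d. real (totient d) / real d ^ s)"
  define z where "z = (\<lambda>t n. 1 / real n ^ t)"
  have f: "(f has_sum suminf f) {0<..}"
    unfolding f_def by (intro has_sum_pos_nat summable_totient_over_power assms) auto
  have z: "(z t has_sum zeta (real t)) {0<..}" if "t \<ge> 2" for t
    unfolding zeta_of_nat[OF that] z_def using that
    by (intro has_sum_pos_nat summable_one_over_power) auto
  have inner: "((\<lambda>e. f d * z s e) has_sum f d * zeta (real s)) {0<..}" for d
    using z[of s] assms by (intro has_sum_cmult_right) auto
  have outer: "((\<lambda>d. f d * zeta (real s)) has_sum suminf f * zeta (real s)) {0<..}"
    by (intro has_sum_cmult_left f)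
  \<comment> \<open>All terms are nonnegative, so summability of the iterated sums suffices.\<close>
  have summ: "(\<lambda>(d, e). f d * z s e) summable_on {0<..} \<times> {0<..}"
    by (rule summable_on_SigmaI[where g = "\<lambda>d. f d * zeta (real s)"])
       (use inner outer in \<open>auto simp: summable_on_def f_def z_def\<close>)
  have "((\<lambda>(d, e). f d * z s e) has_sum suminf f * zeta (real s)) ({0<..} \<times> {0<..})"
    by (rule has_sum_SigmaI[OF _ outer summ]) (use inner in auto)
  also have "?this \<longleftrightarrow> ((\<lambda>(n, d). real (totient d) / real n ^ s) has_sum suminf f * zeta (real s))
      (SIGMA n:{0<..}. {d. d dvd n})"
    by (rule has_sum_reindex_bij_witness[where i = "\<lambda>(n, d). (d, n div d)"
          and j = "\<lambda>(d, e). (d * e, d)"])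
       (auto simp: f_def z_def power_mult_distrib div_greater_zero_iff intro: dvd_pos_nat dvd_imp_le)
  finally have "((\<lambda>n. \<Sum>d | d dvd n. real (totient d) / real n ^ s) has_sum suminf f * zeta (real s)) {0<..}"
    by (rule has_sum_SigmaD) (auto intro!: has_sum_finite)
  also have "?this \<longleftrightarrow> (z (s - 1) has_sum suminf f * zeta (real s)) {0<..}"
  proof (rule has_sum_cong)
    fix n :: nat assume "n \<in> {0<..}"
    moreover have "real n ^ s = real n * real n ^ (s - 1)"
      using assms by (cases s) auto
    moreover have "(\<Sum>d | d dvd n. real (totient d)) = real n"
      by (metis of_nat_sum totient_divisor_sum)
    ultimately show "(\<Sum>d | d dvd n. real (totient d) / real n ^ s) = z (s - 1) n"
      by (simp add: z_def flip: sum_divide_distrib)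
  qed
  finally have "suminf f * zeta (real s) = zeta (real (s - 1))"
    using z[of "s - 1"] assms by (auto intro: has_sum_unique)
  then show ?thesis
    using zeta_of_nat_pos[of s] assms by (simp add: f_def field_simps)
qed

section \<open>Truncation and the error term\<close>

lemma suminf_tail_totient_over_power:
  fixes x :: real
  assumes "s \<ge> 4" "x > 0" "x < real M"
  shows "(\<Sum>i. real (totient (i + M)) / real (i + M) ^ s) \<le> zeta 2 / x"
proof -
  \<comment> \<open>Each term is at most \<open>1 / d ^ 3\<close>; one factor \<open>1 / d\<close>
    is traded for \<open>1 / x\<close>, and the other two keep the series convergent.\<close>
  have le: "real (totient d) / real d ^ s \<le> (1 / x) * (1 / real d ^ 2)" if "d \<ge> M" for d
  proof -
    have d: "real d > x" "d \<ge> 1" using that assms by auto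
    have "real (totient d) / real d ^ s \<le> 1 / real d ^ (s - 1)"
      using totient_over_power_le[of d "s - 1"] assms by simp
    also have "\<dots> \<le> 1 / real d ^ 3"
      using d assms by (intro divide_left_mono power_increasing) auto
    also have "\<dots> = 1 / real d * (1 / real d ^ 2)" by (simp add: eval_nat_numeral)
    also have "\<dots> \<le> (1 / x) * (1 / real d ^ 2)"
      using d assms by (intro mult_right_mono divide_left_mono) auto
    finally show ?thesis .
  qed
  have sq: "summable (\<lambda>i. 1 / real (i + M) ^ 2)"
    using summable_one_over_power[of 2] by (subst summable_iff_shift) auto
  have "(\<Sum>i. real (totient (i + M)) / real (i + M) ^ s) \<le> (\<Sum>i. (1 / x) * (1 / real (i + M) ^ 2))"
  proof (rule suminf_le)
    show "summable (\<lambda>i. real (totient (i + M)) / real (i + M) ^ s)"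
      using summable_totient_over_power[of s] assms
      by (subst summable_iff_shift[where f = "\<lambda>d. real (totient d) / real d ^ s"]) auto
    show "summable (\<lambda>i. (1 / x) * (1 / real (i + M) ^ 2))"
      by (rule summable_mult[OF sq])
  qed (rule le, simp)
  also have "\<dots> = (1 / x) * (\<Sum>i. 1 / real (i + M) ^ 2)"
    by (rule suminf_mult[OF sq])
  also have "\<dots> \<le> (1 / x) * (\<Sum>n. 1 / real n ^ 2)"
    using suminf_split_initial_segment[OF summable_one_over_power[of 2], of M] assms
    by (intro mult_left_mono) (auto simp: sum_nonneg)
  finally show ?thesis using zeta_of_nat[of 2] by simp
qed

text \<open>The finite sum comes from rounding \<open>x / d ^ b\<close> down for each
  \<open>d\<close>, and \<open>zeta 2\<close> from the truncated tail. Keeping the finite sum lets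
  one bound serve both ranges of \<open>b\<close>.\<close>

lemma gen_gcd_sum_error_bound:
  fixes x :: real
  assumes "b \<ge> 2" "x \<ge> 1"
  defines "N \<equiv> nat \<lfloor>x\<rfloor>"
  shows "\<bar>real (\<Sum>n=1..N. gen_gcd_sum b n) - zeta (2 * real b - 1) / (2 * zeta (2 * real b)) * x\<^sup>2\<bar>
    \<le> x / 2 * ((\<Sum>d=1..N. 1 / real d ^ (b - 1)) + zeta 2)"
proof -
  define f where "f = (\<lambda>d. real (totient d) / real d ^ (2 * b))"
  have "real N = real_of_int \<lfloor>x\<rfloor>"
    using assms(2) by (simp add: N_def)
  then have N: "real N \<le> x" "x < real N + 1"
    by linarith+
  have summ: "summable f"
    unfolding f_def using assms(1,2) by (intro summable_totient_over_power) simp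
  have "(\<Sum>d<Suc N. f d) = (\<Sum>d=1..N. f d)"
    by (rule sum.mono_neutral_right) (auto simp: f_def not_le)
  then have split: "suminf f = (\<Sum>d=1..N. f d) + (\<Sum>i. f (i + Suc N))"
    using suminf_split_initial_segment[OF summ, of "Suc N"] by simp
  have tail: "0 \<le> (\<Sum>i. f (i + Suc N))" "(\<Sum>i. f (i + Suc N)) \<le> zeta 2 / x"
  proof -
    show "0 \<le> (\<Sum>i. f (i + Suc N))"
      by (intro suminf_nonneg summable_ignore_initial_segment summ) (simp add: f_def)
    show "(\<Sum>i. f (i + Suc N)) \<le> zeta 2 / x"
      unfolding f_def using assms(1,2) N by (intro suminf_tail_totient_over_power) auto
  qed
  have "suminf f = zeta (2 * real b - 1) / zeta (2 * real b)"
  proof -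
    have "real (2 * b - 1) = 2 * real b - 1"
      using assms(1) by (simp add: of_nat_diff)
    then show ?thesis
      using suminf_totient_over_power[of "2 * b"] assms(1) by (simp add: f_def)
  qed
  then have main: "zeta (2 * real b - 1) / (2 * zeta (2 * real b)) * x\<^sup>2 = x\<^sup>2 / 2 * suminf f"
    by simp
  have summand: "\<bar>real (totient d * \<Sum>{1..N div d ^ b}) - x\<^sup>2 / 2 * f d\<bar> \<le> x / 2 * (1 / real d ^ (b - 1))"
    if "d \<in> {1..N}" for d
  proof -
    define q where "q = d ^ b"
    have "q > 0" using that by (simp add: q_def)
    have "real (N div q) * real q \<le> real N"
      by (metis div_times_less_eq_dividend of_nat_le_iff of_nat_mult)
    then have "real (N div q) \<le> x / real q"
      using N \<open>q > 0\<close> by (simp add: le_divide_eq)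
    \<comment> \<open>By integrality \<open>N < (N div q + 1) * q\<close> improves to
      \<open>N + 1\<close>, which exceeds \<open>x\<close>. Hence \<open>N div q\<close> is also the
      floor of \<open>x / q\<close>.\<close>
    moreover have "x / real q < real (N div q) + 1"
    proof -
      have "N < (N div q + 1) * q"
        using \<open>q > 0\<close> by (metis Suc_eq_plus1 dividend_less_div_times mult_Suc add.commute)
      then have "N + 1 \<le> (N div q + 1) * q" by simp
      then have "real N + 1 \<le> (real (N div q) + 1) * real q"
        by (metis of_nat_1 of_nat_add of_nat_le_iff of_nat_mult)
      then show ?thesis using N \<open>q > 0\<close> by (simp add: divide_less_eq)
    qed
    ultimately have T: "\<bar>real (\<Sum>{1..N div q}) - (x / real q)\<^sup>2 / 2\<bar> \<le> x / real q / 2"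
      by (rule triangular_floor_approx)
    have "x\<^sup>2 / 2 * f d = real (totient d) * ((x / real q)\<^sup>2 / 2)"
      by (simp add: f_def q_def power_divide power_mult[symmetric] mult.commute)
    then have "\<bar>real (totient d * \<Sum>{1..N div q}) - x\<^sup>2 / 2 * f d\<bar>
        = real (totient d) * \<bar>real (\<Sum>{1..N div q}) - (x / real q)\<^sup>2 / 2\<bar>"
      by (simp only: of_nat_mult abs_mult abs_of_nat flip: right_diff_distrib)
    also have "\<dots> \<le> real (totient d) * (x / real q / 2)"
      by (intro mult_left_mono T) simp
    also have "\<dots> = x / 2 * (real (totient d) / real d ^ Suc (b - 1))"
      using assms(1,2) by (simp add: q_def mult.commute)
    also have "\<dots> \<le> x / 2 * (1 / real d ^ (b - 1))"
      using assms(1,2) by (intro mult_left_mono totient_over_power_le) auto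
    finally show ?thesis by (simp add: q_def)
  qed
  have "real (\<Sum>n=1..N. gen_gcd_sum b n) - x\<^sup>2 / 2 * suminf f
      = (\<Sum>d=1..N. real (totient d * \<Sum>{1..N div d ^ b}) - x\<^sup>2 / 2 * f d) - x\<^sup>2 / 2 * (\<Sum>i. f (i + Suc N))"
    unfolding sum_subtractf sum_distrib_left[symmetric] split
    using sum_gen_gcd_sum[of b N] assms(1) by (simp add: algebra_simps)
  also have "\<bar>\<dots>\<bar> \<le> (\<Sum>d=1..N. x / 2 * (1 / real d ^ (b - 1))) + x / 2 * zeta 2"
  proof -
    have "\<bar>\<Sum>d=1..N. real (totient d * \<Sum>{1..N div d ^ b}) - x\<^sup>2 / 2 * f d\<bar>
        \<le> (\<Sum>d=1..N. x / 2 * (1 / real d ^ (b - 1)))"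
      by (rule order_trans[OF sum_abs sum_mono[OF summand]])
    moreover have "x\<^sup>2 / 2 * (\<Sum>i. f (i + Suc N)) \<le> x\<^sup>2 / 2 * (zeta 2 / x)"
      by (intro mult_left_mono tail) simp
    moreover have "x\<^sup>2 / 2 * (zeta 2 / x) = x / 2 * zeta 2"
      using assms(1,2) by (simp add: power2_eq_square)
    moreover have "x\<^sup>2 / 2 * (\<Sum>i. f (i + Suc N)) \<ge> 0"
      using tail by simp
    ultimately show ?thesis by linarith
  qed
  also have "\<dots> = x / 2 * ((\<Sum>d=1..N. 1 / real d ^ (b - 1)) + zeta 2)"
    by (simp only: sum_distrib_left distrib_left)
  finally show ?thesis unfolding main .
qed

text \<open>The difference between the harmonic number and the logarithm decreases from its value 1
  at \<open>N = 1\<close>.\<close>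

lemma harmonic_sum_le:
  assumes "N \<ge> 1"
  shows "(\<Sum>d=1..N. 1 / real d) \<le> 1 + ln (real N)"
  using euler_mascheroni_sequence_decreasing[of 1 N] assms
  by (simp add: harm_def inverse_eq_divide)

theorem theorem1p3:
  fixes b :: nat
  assumes "b \<ge> 2"
  shows "(\<lambda>x::real. (\<Sum>n | 1 \<le> n \<and> real n \<le> x. real (gen_gcd_sum b n))
             - zeta (2 * real b - 1) / (2 * zeta (2 * real b)) * x\<^sup>2)
         \<in> O[at_top](\<lambda>x. if b = 2 then x * ln x else x)"
\<comment> \<open>For \<open>b = 2\<close> the bound is \<open>x / 2 * (1 + ln x + zeta 2)\<close>,
  for larger \<open>b\<close> it is \<open>x * zeta 2\<close>; this constant covers both.\<close>
proof (rule bigoI[where c = "1 + zeta 2"])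
  have z: "zeta 2 > 0" using zeta_of_nat_pos[of 2] by simp
  show "eventually (\<lambda>x::real. norm ((\<Sum>n | 1 \<le> n \<and> real n \<le> x. real (gen_gcd_sum b n))
             - zeta (2 * real b - 1) / (2 * zeta (2 * real b)) * x\<^sup>2)
         \<le> (1 + zeta 2) * norm (if b = 2 then x * ln x else x)) at_top"
    \<comment> \<open>From \<open>exp 1\<close> on, \<open>ln x\<close> is at least 1 and absorbs
      the constants when \<open>b = 2\<close>.\<close>
    using eventually_ge_at_top[of "exp 1"]
  proof eventually_elim
    case (elim x)
    define N where "N = nat \<lfloor>x\<rfloor>"
    have ln: "ln x \<ge> 1" using elim by (smt (verit) exp_gt_zero ln_exp ln_le_cancel_iff)
    have x: "x \<ge> 1" using elim by (smt (verit) one_le_exp_iff)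
    have N: "N \<ge> 1" "real N \<le> x" using x by (auto simp: N_def le_nat_iff)
    have "{n. 1 \<le> n \<and> real n \<le> x} = {1..N}"
      using x by (auto simp: N_def le_nat_floor le_nat_iff le_floor_iff)
    then have "norm ((\<Sum>n | 1 \<le> n \<and> real n \<le> x. real (gen_gcd_sum b n))
             - zeta (2 * real b - 1) / (2 * zeta (2 * real b)) * x\<^sup>2)
        \<le> x / 2 * ((\<Sum>d=1..N. 1 / real d ^ (b - 1)) + zeta 2)"
      using gen_gcd_sum_error_bound[OF assms x] by (simp add: N_def)
    also have "\<dots> \<le> (1 + zeta 2) * norm (if b = 2 then x * ln x else x)"
    proof (cases "b = 2")
      case True
      have "ln (real N) \<le> ln x" using N x by simp
      moreover have "zeta 2 \<le> zeta 2 * ln x" using ln z by simp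
      moreover have "(\<Sum>d=1..N. 1 / real d ^ (b - 1)) \<le> 1 + ln (real N)"
        using harmonic_sum_le[OF N(1)] True by simp
      ultimately have "(\<Sum>d=1..N. 1 / real d ^ (b - 1)) + zeta 2 \<le> 2 * ln x + zeta 2 * ln x"
        using ln by linarith
      also have "\<dots> \<le> 2 * ((1 + zeta 2) * ln x)"
        using ln z by (simp add: algebra_simps)
      finally have "x / 2 * ((\<Sum>d=1..N. 1 / real d ^ (b - 1)) + zeta 2)
          \<le> x / 2 * (2 * ((1 + zeta 2) * ln x))"
        using x by (intro mult_left_mono) auto
      also have "\<dots> = (1 + zeta 2) * norm (if b = 2 then x * ln x else x)"
        using True x ln by (simp add: abs_mult)
      finally show ?thesis .
    next
      case False
      \<comment> \<open>Now \<open>b - 1\<close> is at least 2, so the sum stays bounded.\<close>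
      have "(\<Sum>d=1..N. 1 / real d ^ (b - 1)) \<le> (\<Sum>d=1..N. 1 / real d ^ 2)"
        using assms False by (intro sum_mono divide_left_mono power_increasing) auto
      also have "\<dots> \<le> zeta 2"
        using zeta_of_nat[of 2] sum_le_suminf[OF summable_one_over_power[of 2], of "{1..N}"]
        by simp
      finally have "x / 2 * ((\<Sum>d=1..N. 1 / real d ^ (b - 1)) + zeta 2) \<le> x / 2 * (2 * (1 + zeta 2))"
        using x by (intro mult_left_mono) auto
      also have "\<dots> = (1 + zeta 2) * norm (if b = 2 then x * ln x else x)"
        using False x by simp
      finally show ?thesis .
    qed
    finally show ?case .
  qed
qed

end
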